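(* Let $(Y_0,Y_1,D,X)$ be random variables on a probability space, where $X$ takes values in $\mathcal{X}\subset\mathbb{R}^{d}$, $D\in\{0,1\}$, and $Y_0,Y_1$ are real-valued; put $Y=DY_1+(1-D)Y_0$. Assume that $(Y_0,Y_1)$ is conditionally independent of $D$ given $X$, that there is a constant $0<\epsilon<1/2$ with $\epsilon<P(D=1\mid X)<1-\epsilon$ almost surely, and that $X$ and $Y$ are bounded. Let $\tau_0(x)=\mathbb{E}[Y_1-Y_0\mid X=x]$. Let $\Pi$ be a class of (measurable) deterministic policies $\pi:\mathcal{X}\to\{0,1\}$ and let $\mathcal{G}_\Pi=\{2\pi-1:\pi\in\Pi\}$, a class of functions $\mathcal{X}\to\{-1,1\}$. Define $$\pi^*=\operatorname*{arg\,max}_{\pi\in\Pi}\mathbb{E}\left[\pi(X)Y_1+(1-\pi(X))Y_0\right],\qquad g^*=\operatorname*{arg\,min}_{g\in\mathcal{G}_\Pi}\mathbb{E}\left[\left(\tau_0(X)-g(X)\right)^2\right].$$ Then $g^*=2\pi^*-1$, that is, for every $\pi\in\Pi$, the function $2\pi-1$ minimizes $\mathbb{E}[(\tau_0(X)-g(X))^2]$ over $g\in\mathcal{G}_\Pi$ if and only if $\pi$ maximizes $\mathbb{E}[\pi(X)Y_1+(1-\pi(X))Y_0]$ over $\Pi$.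
   Context: $Y_1$ and $Y_0$ are the potential outcomes under treatments $1$ and $0$, $D$ is the treatment indicator, $X$ is the covariate vector and $Y$ is the observed outcome. A deterministic policy $\pi$ recommends treatment $1$ at $x$ if $\pi(x)=1$ and treatment $0$ if $\pi(x)=0$. The quantity $W(\pi)=\mathbb{E}[\pi(X)Y_1+(1-\pi(X))Y_0]$ is the (utilitarian) social welfare, or policy value, of $\pi$, and $\tau_0$ is the conditional average treatment effect (CATE). *)

theory Defs
  imports "HOL-Probability.Probability"
begin

abbreviation sigma_rv :: "'a measure \<Rightarrow> 'b measure \<Rightarrow> ('a \<Rightarrow> 'b) \<Rightarrow> 'a measure" where
  "sigma_rv M N X \<equiv> vimage_algebra (space M) X N"

definition cond_exp_given :: "'a measure \<Rightarrow> 'b measure \<Rightarrow> ('a \<Rightarrow> 'b) \<Rightarrow> ('a \<Rightarrow> real) \<Rightarrow> 'a \<Rightarrow> real" where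
  "cond_exp_given M N X Z = real_cond_exp M (sigma_rv M N X) Z"

definition cond_prob_given :: "'a measure \<Rightarrow> 'b measure \<Rightarrow> ('a \<Rightarrow> 'b) \<Rightarrow> 'a set \<Rightarrow> 'a \<Rightarrow> real" where
  "cond_prob_given M N X A = cond_exp_given M N X (indicator A)"

definition cond_indep_rv ::
  "'a measure \<Rightarrow> 'b measure \<Rightarrow> ('a \<Rightarrow> 'b) \<Rightarrow> 'c measure \<Rightarrow> ('a \<Rightarrow> 'c) \<Rightarrow> 'd measure \<Rightarrow> ('a \<Rightarrow> 'd) \<Rightarrow> bool" where
  "cond_indep_rv M S U T V N X \<longleftrightarrow>
     (\<forall>A\<in>sets S. \<forall>B\<in>sets T. AE \<omega> in M.
        cond_prob_given M N X {\<omega>\<in>space M. U \<omega> \<in> A \<and> V \<omega> \<in> B} \<omega> =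
        cond_prob_given M N X {\<omega>\<in>space M. U \<omega> \<in> A} \<omega> *
        cond_prob_given M N X {\<omega>\<in>space M. V \<omega> \<in> B} \<omega>)"

text \<open>A function \<open>x \<mapsto> E[Z | X = x]\<close> is only determined up to null sets of the law of \<open>X\<close>. The
  following predicate says that \<open>h\<close> is one of its versions: a measurable function of \<open>x\<close> with
  \<open>h(X) = E[Z | X]\<close> almost surely.\<close>

definition is_regression_fun ::
  "'a measure \<Rightarrow> 'b measure \<Rightarrow> ('a \<Rightarrow> 'b) \<Rightarrow> ('a \<Rightarrow> real) \<Rightarrow> ('b \<Rightarrow> real) \<Rightarrow> bool" where
  "is_regression_fun M N X Z h \<longleftrightarrow>
     h \<in> borel_measurable N \<and> (AE \<omega> in M. h (X \<omega>) = cond_exp_given M N X Z \<omega>)"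

definition as_bounded :: "'a measure \<Rightarrow> ('a \<Rightarrow> 'b::real_normed_vector) \<Rightarrow> bool" where
  "as_bounded M Z \<longleftrightarrow> (\<exists>C. AE \<omega> in M. norm (Z \<omega>) \<le> C)"

text \<open>Policies on the measurable space \<open>N\<close>. The values of a policy outside \<open>space N\<close> are irrelevant
  and left unconstrained.\<close>

definition policies :: "'b measure \<Rightarrow> ('b \<Rightarrow> real) set" where
  "policies N = {\<pi> \<in> borel_measurable N. \<forall>x\<in>space N. \<pi> x \<in> {0, 1}}"

definition signed_policy :: "('b \<Rightarrow> real) \<Rightarrow> 'b \<Rightarrow> real" where
  "signed_policy \<pi> = (\<lambda>x. 2 * \<pi> x - 1)"

definition welfare ::
  "'a measure \<Rightarrow> ('a \<Rightarrow> 'b) \<Rightarrow> ('a \<Rightarrow> real) \<Rightarrow> ('a \<Rightarrow> real) \<Rightarrow> ('b \<Rightarrow> real) \<Rightarrow> real" where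
  "welfare M X Y\<^sub>0 Y\<^sub>1 \<pi> = (\<integral>\<omega>. \<pi> (X \<omega>) * Y\<^sub>1 \<omega> + (1 - \<pi> (X \<omega>)) * Y\<^sub>0 \<omega> \<partial>M)"

definition squared_loss :: "'a measure \<Rightarrow> ('a \<Rightarrow> 'b) \<Rightarrow> ('b \<Rightarrow> real) \<Rightarrow> ('b \<Rightarrow> real) \<Rightarrow> real" where
  "squared_loss M X \<tau> g = (\<integral>\<omega>. (\<tau> (X \<omega>) - g (X \<omega>))\<^sup>2 \<partial>M)"

end

theory Submission
  imports Defs
begin

text \<open>Since every signed policy takes values in \<open>{-1, 1}\<close>, expanding the square leaves only the cross
  term \<open>E[\<tau>\<^sub>0(X) g(X)]\<close> dependent on \<open>g\<close>, and by the tower property it is an affine function of the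
  welfare. For this to make sense both potential outcomes must be integrable: conditional
  independence and overlap transfer the bound on \<open>Y\<close> to \<open>Y\<^sub>0\<close> and \<open>Y\<^sub>1\<close>.\<close>

lemma (in prob_space) finite_measure_subalgebra_vimage_algebra:
  assumes "X \<in> measurable M N"
  shows "finite_measure_subalgebra M (vimage_algebra (space M) X N)"
proof
  show "subalgebra M (vimage_algebra (space M) X N)"
    using assms by (auto simp: subalgebra_def measurable_def sets_vimage_algebra2)
qed

text \<open>The joint event is null, so its conditional probability given \<open>X\<close> vanishes
  almost surely. This probability factors, and the factor of \<open>V\<close> is positive, so the
  factor of \<open>U\<close> must vanish. Integrating that factor gives the unconditional
  probability.\<close>

lemma (in prob_space) AE_notin_if_cond_indep_rv:
  assumes [measurable]: "X \<in> measurable M N" "U \<in> measurable M S" "V \<in> measurable M T"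
    "A \<in> sets S" "B \<in> sets T"
    and indep: "cond_indep_rv M S U T V N X"
    and pos: "AE \<omega> in M. 0 < cond_prob_given M N X {\<omega>\<in>space M. V \<omega> \<in> B} \<omega>"
    and null: "AE \<omega> in M. \<not> (U \<omega> \<in> A \<and> V \<omega> \<in> B)"
  shows "AE \<omega> in M. U \<omega> \<notin> A"
proof -
  let ?F = "vimage_algebra (space M) X N"
  interpret F: finite_measure_subalgebra M ?F
    by (rule finite_measure_subalgebra_vimage_algebra) fact
  let ?A = "{\<omega>\<in>space M. U \<omega> \<in> A}" and ?AB = "{\<omega>\<in>space M. U \<omega> \<in> A \<and> V \<omega> \<in> B}"
  have int: "integrable M (indicator ?A :: 'a \<Rightarrow> real)"
    by (intro integrable_real_indicator) (auto simp: less_top[symmetric])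
  have "AE \<omega> in M. real_cond_exp M ?F (indicator ?AB) \<omega> = real_cond_exp M ?F (\<lambda>_. 0) \<omega>"
    by (rule F.real_cond_exp_cong) (use null in \<open>auto simp: indicator_def\<close>)
  moreover have "AE \<omega> in M. real_cond_exp M ?F (\<lambda>_. 0) \<omega> = 0"
    by (rule F.real_cond_exp_F_meas) auto
  moreover have "AE \<omega> in M. cond_prob_given M N X ?AB \<omega> =
      cond_prob_given M N X ?A \<omega> * cond_prob_given M N X {\<omega>\<in>space M. V \<omega> \<in> B} \<omega>"
    using indep assms(4,5) unfolding cond_indep_rv_def by blast
  ultimately have "AE \<omega> in M. real_cond_exp M ?F (indicator ?A) \<omega> = 0"
    using pos by eventually_elim (auto simp: cond_prob_given_def cond_exp_given_def)
  then have "(\<integral>\<omega>. real_cond_exp M ?F (indicator ?A) \<omega> \<partial>M) = 0"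
    by (simp add: integral_eq_zero_AE)
  then have "prob ?A = 0"
    using F.real_cond_exp_int(2)[OF int] by simp
  then show ?thesis
    by (subst (asm) prob_eq_0) auto
qed

text \<open>A potential outcome is seen only in its own treatment arm, so the bound on
  \<open>Y\<close> controls it only there. Since each arm has positive conditional probability, the
  previous lemma excludes large values in the other arm too. Here \<open>B\<close> is the arm and
  \<open>f\<close> selects the outcome from the pair \<open>U\<close>.\<close>

lemma (in prob_space) as_bounded_if_cond_indep_rv:
  fixes U :: "'a \<Rightarrow> 'c" and f :: "'c \<Rightarrow> real" and Y :: "'a \<Rightarrow> real"
  assumes [measurable]: "X \<in> measurable M N" "U \<in> measurable M S" "V \<in> measurable M T"
    "f \<in> borel_measurable S" "B \<in> sets T"
    and indep: "cond_indep_rv M S U T V N X"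
    and pos: "AE \<omega> in M. 0 < cond_prob_given M N X {\<omega>\<in>space M. V \<omega> \<in> B} \<omega>"
    and eq: "\<And>\<omega>. \<omega> \<in> space M \<Longrightarrow> V \<omega> \<in> B \<Longrightarrow> Y \<omega> = f (U \<omega>)"
    and bounded: "as_bounded M Y"
  shows "as_bounded M (\<lambda>\<omega>. f (U \<omega>))"
proof -
  obtain C where C: "AE \<omega> in M. \<bar>Y \<omega>\<bar> \<le> C"
    using bounded by (auto simp: as_bounded_def)
  have "AE \<omega> in M. \<not> (U \<omega> \<in> {u \<in> space S. C < \<bar>f u\<bar>} \<and> V \<omega> \<in> B)"
    using C AE_space by eventually_elim (use eq in auto)
  then have "AE \<omega> in M. U \<omega> \<notin> {u \<in> space S. C < \<bar>f u\<bar>}"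
    by (rule AE_notin_if_cond_indep_rv[OF assms(1-3) _ assms(5) indep pos, rotated]) simp
  then have "AE \<omega> in M. \<bar>f (U \<omega>)\<bar> \<le> C"
    using AE_space by eventually_elim (use measurable_space[OF assms(2)] in auto)
  then show ?thesis
    by (auto simp: as_bounded_def)
qed

lemma (in prob_space) as_bounded_integrable:
  fixes Z :: "'a \<Rightarrow> real"
  assumes "as_bounded M Z" "Z \<in> borel_measurable M"
  shows "integrable M Z"
  using assms unfolding as_bounded_def by (blast intro: integrable_const_bound)

lemma as_bounded_mult:
  fixes Z W :: "'a \<Rightarrow> real"
  assumes "as_bounded M Z" "as_bounded M W"
  shows "as_bounded M (\<lambda>\<omega>. Z \<omega> * W \<omega>)"
proof -
  obtain B C where "AE \<omega> in M. \<bar>Z \<omega>\<bar> \<le> B" "AE \<omega> in M. \<bar>W \<omega>\<bar> \<le> C"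
    using assms by (auto simp: as_bounded_def)
  \<comment> \<open>Monotonicity of multiplication needs \<open>B\<close> nonnegative; this follows
    at each such point from 0 \<le> \<open>\<bar>Z \<omega>\<bar>\<close> \<le>
    \<open>B\<close>.\<close>
  then have "AE \<omega> in M. \<bar>Z \<omega> * W \<omega>\<bar> \<le> B * C"
    by eventually_elim (auto simp: abs_mult intro: mult_mono order_trans[OF abs_ge_zero])
  then show ?thesis
    by (auto simp: as_bounded_def)
qed

lemma as_bounded_diff:
  assumes "as_bounded M Z" "as_bounded M W"
  shows "as_bounded M (\<lambda>\<omega>. Z \<omega> - W \<omega>)"
proof -
  obtain B C where "AE \<omega> in M. norm (Z \<omega>) \<le> B" "AE \<omega> in M. norm (W \<omega>) \<le> C"
    using assms by (auto simp: as_bounded_def)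
  then have "AE \<omega> in M. norm (Z \<omega> - W \<omega>) \<le> B + C"
    by eventually_elim (rule norm_triangle_le_diff, simp)
  then show ?thesis
    by (auto simp: as_bounded_def)
qed

text \<open>Conditional expectation is monotone and preserves constants, so the bounds
  \<open>- C\<close> and \<open>C\<close> pass from \<open>Z\<close> to
  \<open>h (X \<omega>)\<close>. This will make the square of the CATE integrable.\<close>

lemma (in prob_space) is_regression_fun_as_bounded:
  assumes X: "X \<in> measurable M N" and Z: "Z \<in> borel_measurable M" "as_bounded M Z"
    and h: "is_regression_fun M N X Z h"
  shows "as_bounded M (\<lambda>\<omega>. h (X \<omega>))"
proof -
  let ?F = "vimage_algebra (space M) X N"
  interpret F: finite_measure_subalgebra M ?F
    using X by (rule finite_measure_subalgebra_vimage_algebra)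
  obtain C where C: "AE \<omega> in M. \<bar>Z \<omega>\<bar> \<le> C"
    using Z(2) by (auto simp: as_bounded_def)
  note int = as_bounded_integrable[OF Z(2,1)]
  have "AE \<omega> in M. real_cond_exp M ?F Z \<omega> \<ge> - C"
    by (rule F.real_cond_exp_ge_c[OF int]) (use C in \<open>eventually_elim, auto\<close>)
  moreover have "AE \<omega> in M. real_cond_exp M ?F Z \<omega> \<le> C"
    by (rule F.real_cond_exp_le_c[OF int]) (use C in \<open>eventually_elim, auto\<close>)
  moreover have "AE \<omega> in M. h (X \<omega>) = real_cond_exp M ?F Z \<omega>"
    using h by (simp add: is_regression_fun_def cond_exp_given_def)
  ultimately have "AE \<omega> in M. \<bar>h (X \<omega>)\<bar> \<le> C"
    by eventually_elim auto
  then show ?thesis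
    by (auto simp: as_bounded_def)
qed

text \<open>The tower property with a known factor: \<open>p (X \<omega>)\<close> is measurable for
  the sigma-algebra generated by \<open>X\<close>, so it can be moved inside the conditional
  expectation before integrating.\<close>

lemma (in prob_space) integral_mult_regression_fun:
  assumes [measurable]: "X \<in> measurable M N" "p \<in> borel_measurable N"
    and Z: "Z \<in> borel_measurable M"
    and int: "integrable M (\<lambda>\<omega>. p (X \<omega>) * Z \<omega>)"
    and h: "is_regression_fun M N X Z h"
  shows "(\<integral>\<omega>. p (X \<omega>) * h (X \<omega>) \<partial>M) = (\<integral>\<omega>. p (X \<omega>) * Z \<omega> \<partial>M)"
proof -
  let ?F = "vimage_algebra (space M) X N"
  interpret F: finite_measure_subalgebra M ?F
    by (rule finite_measure_subalgebra_vimage_algebra) fact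
  have [measurable]: "X \<in> measurable ?F N"
    using assms(1) by (intro measurable_vimage_algebra1) (auto simp: measurable_def)
  have [measurable]: "h \<in> borel_measurable N" and
    eq: "AE \<omega> in M. h (X \<omega>) = real_cond_exp M ?F Z \<omega>"
    using h by (auto simp: is_regression_fun_def cond_exp_given_def)
  have "(\<integral>\<omega>. p (X \<omega>) * h (X \<omega>) \<partial>M) = (\<integral>\<omega>. p (X \<omega>) * real_cond_exp M ?F Z \<omega> \<partial>M)"
    by (rule integral_cong_AE) (use eq in auto)
  also have "\<dots> = (\<integral>\<omega>. p (X \<omega>) * Z \<omega> \<partial>M)"
    by (rule F.real_cond_exp_intg(2)) (use int Z in measurable)
  finally show ?thesis .
qed

text \<open>The first two terms on the right do not involve \<open>p\<close>, and the slope
  \<open>-4\<close> in the welfare is negative, so the loss orders policies in reverse to the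
  welfare.\<close>

lemma (in prob_space) squared_loss_signed_policy:
  assumes [measurable]: "X \<in> measurable M N" "Y\<^sub>0 \<in> borel_measurable M" "Y\<^sub>1 \<in> borel_measurable M"
    and bounded: "as_bounded M Y\<^sub>0" "as_bounded M Y\<^sub>1"
    and \<tau>: "is_regression_fun M N X (\<lambda>\<omega>. Y\<^sub>1 \<omega> - Y\<^sub>0 \<omega>) \<tau>"
    and p: "p \<in> policies N"
  shows "squared_loss M X \<tau> (signed_policy p) =
    (\<integral>\<omega>. (\<tau> (X \<omega>) + 1)\<^sup>2 \<partial>M) + 4 * expectation Y\<^sub>0 - 4 * welfare M X Y\<^sub>0 Y\<^sub>1 p"
proof -
  have [measurable]: "p \<in> borel_measurable N" "\<tau> \<in> borel_measurable N"
    using p \<tau> by (auto simp: policies_def is_regression_fun_def)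
  have p01: "p (X \<omega>) = 0 \<or> p (X \<omega>) = 1" if "\<omega> \<in> space M" for \<omega>
    using p measurable_space[OF assms(1) that] by (auto simp: policies_def)
  have bp: "as_bounded M (\<lambda>\<omega>. p (X \<omega>))"
    unfolding as_bounded_def by (intro exI[of _ 1] AE_I2) (use p01 in force)
  have b\<Delta>: "as_bounded M (\<lambda>\<omega>. Y\<^sub>1 \<omega> - Y\<^sub>0 \<omega>)"
    using bounded by (intro as_bounded_diff)
  have b\<tau>: "as_bounded M (\<lambda>\<omega>. \<tau> (X \<omega>))"
    by (rule is_regression_fun_as_bounded[OF assms(1) _ b\<Delta> \<tau>]) simp
  have int0: "integrable M Y\<^sub>0"
    by (rule as_bounded_integrable[OF bounded(1)]) simp
  have int\<Delta>: "integrable M (\<lambda>\<omega>. p (X \<omega>) * (Y\<^sub>1 \<omega> - Y\<^sub>0 \<omega>))"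
    by (rule as_bounded_integrable[OF as_bounded_mult[OF bp b\<Delta>]]) simp
  have intp\<tau>: "integrable M (\<lambda>\<omega>. p (X \<omega>) * \<tau> (X \<omega>))"
    by (rule as_bounded_integrable[OF as_bounded_mult[OF bp b\<tau>]]) simp
  have int\<tau>: "integrable M (\<lambda>\<omega>. \<tau> (X \<omega>))"
    by (rule as_bounded_integrable[OF b\<tau>]) simp
  \<comment> \<open>Expanding the square in the constant term leaves the second moment of
    \<open>\<tau> (X \<omega>)\<close>, which is finite by boundedness.\<close>
  have "integrable M (\<lambda>\<omega>. \<tau> (X \<omega>) * \<tau> (X \<omega>))"
    by (rule as_bounded_integrable[OF as_bounded_mult[OF b\<tau> b\<tau>]]) simp
  then have int1: "integrable M (\<lambda>\<omega>. (\<tau> (X \<omega>) + 1)\<^sup>2)"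
    using int\<tau> by (simp add: power2_eq_square algebra_simps)
  \<comment> \<open>For \<open>p\<close> in {0, 1} one has p^2 = p, hence (\<tau> - (2p - 1))^2 =
    (\<tau> + 1)^2 - 4p(\<tau> + 1) + 4p^2 = (\<tau> + 1)^2 - 4p\<tau>.\<close>
  have "squared_loss M X \<tau> (signed_policy p) =
      (\<integral>\<omega>. (\<tau> (X \<omega>) + 1)\<^sup>2 - 4 * (p (X \<omega>) * \<tau> (X \<omega>)) \<partial>M)"
    unfolding squared_loss_def signed_policy_def
    by (rule Bochner_Integration.integral_cong[OF refl], drule p01)
      (auto simp: power2_eq_square algebra_simps)
  also have "\<dots> = (\<integral>\<omega>. (\<tau> (X \<omega>) + 1)\<^sup>2 \<partial>M) - 4 * (\<integral>\<omega>. p (X \<omega>) * \<tau> (X \<omega>) \<partial>M)"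
    using int1 intp\<tau> by simp
  also have "(\<integral>\<omega>. p (X \<omega>) * \<tau> (X \<omega>) \<partial>M) = (\<integral>\<omega>. p (X \<omega>) * (Y\<^sub>1 \<omega> - Y\<^sub>0 \<omega>) \<partial>M)"
    by (rule integral_mult_regression_fun[OF _ _ _ int\<Delta> \<tau>]) auto
  finally have loss: "squared_loss M X \<tau> (signed_policy p) =
    (\<integral>\<omega>. (\<tau> (X \<omega>) + 1)\<^sup>2 \<partial>M) - 4 * (\<integral>\<omega>. p (X \<omega>) * (Y\<^sub>1 \<omega> - Y\<^sub>0 \<omega>) \<partial>M)" .
  \<comment> \<open>Treating nobody yields the baseline \<open>expectation Y\<^sub>0\<close>; the
    policy adds the effect on those it treats.\<close>
  have "welfare M X Y\<^sub>0 Y\<^sub>1 p = (\<integral>\<omega>. p (X \<omega>) * (Y\<^sub>1 \<omega> - Y\<^sub>0 \<omega>) + Y\<^sub>0 \<omega> \<partial>M)"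
    by (simp add: welfare_def algebra_simps)
  also have "\<dots> = (\<integral>\<omega>. p (X \<omega>) * (Y\<^sub>1 \<omega> - Y\<^sub>0 \<omega>) \<partial>M) + expectation Y\<^sub>0"
    by (rule Bochner_Integration.integral_add[OF int\<Delta> int0])
  finally show ?thesis
    using loss by simp
qed

theorem theorem3p1:
  fixes M :: "'a measure"
    and S :: "(real ^ 'd) set"
    and X :: "'a \<Rightarrow> real ^ 'd"
    and Y\<^sub>0 Y\<^sub>1 D Y :: "'a \<Rightarrow> real"
    and \<tau>\<^sub>0 :: "real ^ 'd \<Rightarrow> real"
    and \<P> :: "(real ^ 'd \<Rightarrow> real) set"
    and \<epsilon> :: real
  defines "\<X> \<equiv> restrict_space borel S"
  assumes "prob_space M"
    and "X \<in> measurable M \<X>"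
    and "Y\<^sub>0 \<in> borel_measurable M"
    and "Y\<^sub>1 \<in> borel_measurable M"
    and "D \<in> borel_measurable M"
    and "\<And>\<omega>. \<omega> \<in> space M \<Longrightarrow> D \<omega> \<in> {0, 1}"
    and "\<And>\<omega>. \<omega> \<in> space M \<Longrightarrow> Y \<omega> = D \<omega> * Y\<^sub>1 \<omega> + (1 - D \<omega>) * Y\<^sub>0 \<omega>"
    and "cond_indep_rv M borel (\<lambda>\<omega>. (Y\<^sub>0 \<omega>, Y\<^sub>1 \<omega>)) borel D \<X> X"
    and "0 < \<epsilon>" and "\<epsilon> < 1 / 2"
    and "AE \<omega> in M. \<epsilon> < cond_prob_given M \<X> X {\<omega>\<in>space M. D \<omega> = 1} \<omega> \<and>
                     cond_prob_given M \<X> X {\<omega>\<in>space M. D \<omega> = 1} \<omega> < 1 - \<epsilon>"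
    and "as_bounded M X"
    and "as_bounded M Y"
    and "is_regression_fun M \<X> X (\<lambda>\<omega>. Y\<^sub>1 \<omega> - Y\<^sub>0 \<omega>) \<tau>\<^sub>0"
    and "\<P> \<subseteq> policies \<X>"
  shows "\<forall>\<pi>\<in>\<P>. is_arg_min (squared_loss M X \<tau>\<^sub>0) (\<lambda>g. g \<in> signed_policy ` \<P>) (signed_policy \<pi>) \<longleftrightarrow>
                is_arg_max (welfare M X Y\<^sub>0 Y\<^sub>1) (\<lambda>\<pi>. \<pi> \<in> \<P>) \<pi>"
proof -
  interpret prob_space M by fact
  note [measurable] = assms(3-6)
  interpret F: finite_measure_subalgebra M "vimage_algebra (space M) X \<X>"
    by (rule finite_measure_subalgebra_vimage_algebra) fact
  have D01: "D \<omega> = 0 \<or> D \<omega> = 1" if "\<omega> \<in> space M" for \<omega>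
    using assms(7)[OF that] by simp
  have pos1: "AE \<omega> in M. 0 < cond_prob_given M \<X> X {\<omega>\<in>space M. D \<omega> \<in> {1}} \<omega>"
    using assms(12) by eventually_elim (use \<open>0 < \<epsilon>\<close> in auto)
  \<comment> \<open>The upper overlap bound serves the untreated arm: P(D = 0 | X) = 1 - P(D = 1 |
    X) > \<epsilon>.\<close>
  have pos0: "AE \<omega> in M. 0 < cond_prob_given M \<X> X {\<omega>\<in>space M. D \<omega> \<in> {0}} \<omega>"
  proof -
    let ?F = "vimage_algebra (space M) X \<X>"
    let ?D = "\<lambda>d. indicator {\<omega>\<in>space M. D \<omega> = d} :: 'a \<Rightarrow> real"
    have int: "integrable M (?D 1)"
      by (intro integrable_real_indicator) (auto simp: less_top[symmetric])
    have "AE \<omega> in M. real_cond_exp M ?F (?D 0) \<omega> = real_cond_exp M ?F (\<lambda>\<omega>. 1 - ?D 1 \<omega>) \<omega>"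
      by (rule F.real_cond_exp_cong) (auto simp: indicator_def dest: D01 intro!: AE_I2)
    moreover have "AE \<omega> in M. real_cond_exp M ?F (\<lambda>\<omega>. 1 - ?D 1 \<omega>) \<omega> =
        real_cond_exp M ?F (\<lambda>_. 1) \<omega> - real_cond_exp M ?F (?D 1) \<omega>"
      by (rule F.real_cond_exp_diff) (use int in auto)
    moreover have "AE \<omega> in M. real_cond_exp M ?F (\<lambda>_. 1) \<omega> = 1"
      by (rule F.real_cond_exp_F_meas) auto
    ultimately show ?thesis
      using assms(12)
      by eventually_elim (use \<open>0 < \<epsilon>\<close> in \<open>auto simp: cond_prob_given_def cond_exp_given_def\<close>)
  qed
  \<comment> \<open>In the arm \<open>D \<omega> = 0\<close> the observed outcome is the first
    component of the pair. Measurability of the pair is shown for the product of the Borel algebras,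
    which \<open>borel_prod\<close> identifies with the Borel algebra on pairs.\<close>
  have b0: "as_bounded M Y\<^sub>0"
    using as_bounded_if_cond_indep_rv[OF _ _ _ _ _ assms(9) pos0 _ \<open>as_bounded M Y\<close>, where f = fst]
    by (simp add: assms(8) borel_prod[symmetric])
  have b1: "as_bounded M Y\<^sub>1"
    using as_bounded_if_cond_indep_rv[OF _ _ _ _ _ assms(9) pos1 _ \<open>as_bounded M Y\<close>, where f = snd]
    by (simp add: assms(8) borel_prod[symmetric])
  \<comment> \<open>Strict comparisons are what \<open>is_arg_min\<close> and
    \<open>is_arg_max\<close> speak of: no competitor is strictly better. Every competitor for the
    loss is the signed version of some \<open>q\<close> in \<open>\<P>\<close>, so the two
    conditions match.\<close>
  have "squared_loss M X \<tau>\<^sub>0 (signed_policy q) < squared_loss M X \<tau>\<^sub>0 (signed_policy p) \<longleftrightarrow>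
      welfare M X Y\<^sub>0 Y\<^sub>1 p < welfare M X Y\<^sub>0 Y\<^sub>1 q" if "p \<in> \<P>" "q \<in> \<P>" for p q
    using squared_loss_signed_policy[OF assms(3-5) b0 b1 assms(15)] that \<open>\<P> \<subseteq> policies \<X>\<close>
    by (simp add: subset_iff)
  then show ?thesis
    by (auto simp: is_arg_min_def is_arg_max_def)
qed

end
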